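(* If $n$ is a non-negative integer and $p$ is a non-zero integer, then $$\sum_{k=0}^n(-1)^{p(n-k)}\frac{n}{n+k}\binom{n+k}{n-k}\left(\frac{F_{3p}}{F_{2p}}\right)^{2k}=\frac{L_p^{4n}+1}{2L_p^{2n}},$$ $$\sum_{k=0}^n(-1)^{(p+1)(n-k)}\frac{n}{n+k}\binom{n+k}{n-k}5^{n-k}\left(\frac{L_{3p}}{F_{2p}}\right)^{2k}=\frac{5^{2n}F_p^{4n}+1}{2F_p^{2n}}.$$
   Context: $F_n$ and $L_n$ ($n\in\mathbb{Z}$) are the Fibonacci and Lucas numbers: $F_0=0$, $F_1=1$, $F_n=F_{n-1}+F_{n-2}$; $L_0=2$, $L_1=1$, $L_n=L_{n-1}+L_{n-2}$, extended to negative indices by $F_{-n}=(-1)^{n-1}F_n$, $L_{-n}=(-1)^nL_n$. The coefficient $\frac{n}{n+k}\binom{n+k}{n-k}$ equals $\binom{n+k-1}{k}\binom{n}{k}/\binom{2k}{k}$; for $n=k=0$ it is understood to be $1$. *)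

theory Defs
  imports Complex_Main "HOL-Number_Theory.Fib"
begin

definition fib_int :: "int \<Rightarrow> int" where
  "fib_int n = (if n \<ge> 0 then int (fib (nat n))
                else (-1) ^ (nat (-n) - 1) * int (fib (nat (-n))))"

fun lucas :: "nat \<Rightarrow> nat" where
  "lucas 0 = 2"
| "lucas (Suc 0) = 1"
| "lucas (Suc (Suc n)) = lucas (Suc n) + lucas n"

definition lucas_int :: "int \<Rightarrow> int" where
  "lucas_int n = (if n \<ge> 0 then int (lucas (nat n))
                  else (-1) ^ nat (-n) * int (lucas (nat (-n))))"

(* The case n = k = 0 is split off because 0 / 0 = 0 in HOL, whereas the
   coefficient is conventionally 1 there. *)
definition ncoeff :: "nat \<Rightarrow> nat \<Rightarrow> real" where
  "ncoeff n k = (if n = 0 \<and> k = 0 then 1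
                 else real n / real (n + k) * real ((n + k) choose (n - k)))"

lemma fib_int_minus: "fib_int (- int n) = (-1) ^ (n - 1) * fib_int (int n)"
  by (cases n) (auto simp: fib_int_def nat_add_distrib)

lemma lucas_int_minus: "lucas_int (- int n) = (-1) ^ n * lucas_int (int n)"
  by (cases n) (auto simp: lucas_int_def nat_add_distrib)

lemma fib_int_rec: "fib_int n = fib_int (n - 1) + fib_int (n - 2)"
proof -
  consider (a) m where "n = int (Suc (Suc m))" | (b) "n = 1" | (c) "n = 0"
    | (d) m where "n = - int (Suc m)"
    by (metis int_cases negative_eq_positive of_nat_0 of_nat_1 One_nat_def not0_implies_Suc)
  then show ?thesis
  proof cases
    case (a m)
    have "nat (n - 1) = Suc m" "nat (n - 2) = m" "nat n = Suc (Suc m)"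
      using a by auto
    with a show ?thesis by (simp add: fib_int_def)
  next
    case (d m)
    have "nat (-n) = Suc m" "nat (-(n - 1)) = Suc (Suc m)" "nat (-(n - 2)) = Suc (Suc (Suc m))"
      using d by auto
    with d show ?thesis by (simp add: fib_int_def algebra_simps)
  qed (simp_all add: fib_int_def numeral_2_eq_2)
qed

lemma lucas_int_rec: "lucas_int n = lucas_int (n - 1) + lucas_int (n - 2)"
proof -
  consider (a) m where "n = int (Suc (Suc m))" | (b) "n = 1" | (c) "n = 0"
    | (d) m where "n = - int (Suc m)"
    by (metis int_cases negative_eq_positive of_nat_0 of_nat_1 One_nat_def not0_implies_Suc)
  then show ?thesis
  proof cases
    case (a m)
    have "nat (n - 1) = Suc m" "nat (n - 2) = m" "nat n = Suc (Suc m)"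
      using a by auto
    with a show ?thesis by (simp add: lucas_int_def)
  next
    case (d m)
    have "nat (-n) = Suc m" "nat (-(n - 1)) = Suc (Suc m)" "nat (-(n - 2)) = Suc (Suc (Suc m))"
      using d by auto
    with d show ?thesis by (simp add: lucas_int_def algebra_simps)
  qed (simp_all add: lucas_int_def numeral_2_eq_2)
qed

end

theory Submission
  imports Defs
begin

text \<open>
  With \<open>s = (-1)\<^sup>p\<close>, both sums have the form \<open>\<Sum> c\<^sup>n\<^sup>-\<^sup>k (n/(n+k)) C(n+k, n-k) z\<^sup>k\<close>. Its coefficients are the
  averages \<open>(C(n+k, 2k) + C(n+k-1, 2k)) / 2\<close>, so Pascal's rule gives a second order recurrence in
  \<open>n\<close>, which \<open>z = c (w + 1/w - 2)\<close> solves as \<open>c\<^sup>n (w\<^sup>n + w\<^sup>-\<^sup>n) / 2\<close>. From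
  \<open>F\<^sub>3\<^sub>p / F\<^sub>2\<^sub>p = L\<^sub>p - s / L\<^sub>p\<close> and \<open>L\<^sub>3\<^sub>p / F\<^sub>2\<^sub>p = 5 F\<^sub>p + s / F\<^sub>p\<close> one reads off
  \<open>c = s, w = s L\<^sub>p\<^sup>2\<close> for the first identity and \<open>c = -5 s, w = -5 s F\<^sub>p\<^sup>2\<close> for the second.
\<close>

section \<open>The coefficients and the polynomials they generate\<close>

(* Unlike ncoeff, this form vanishes for k > n. *)
definition avg_binom :: "nat \<Rightarrow> nat \<Rightarrow> real" where
  "avg_binom n k = (real ((n + k) choose (2 * k)) + real ((n + k - 1) choose (2 * k))) / 2"

text \<open>Absorption gives \<open>(n - k) C(n+k, 2k) = (n + k) C(n+k-1, 2k)\<close>, so the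
  average is \<open>C(n+k, 2k)\<close> times \<open>(1 + (n-k)/(n+k)) / 2 = n/(n+k)\<close>. For
  \<open>n = k = 0\<close> truncated subtraction reads \<open>n + k - 1\<close> as 0, and both sides
  are 1.\<close>

lemma ncoeff_eq_avg_binom:
  assumes "k \<le> n"
  shows "ncoeff n k = avg_binom n k"
proof (cases "n = 0")
  case True
  then show ?thesis using assms by (simp add: ncoeff_def avg_binom_def)
next
  case False
  define m where "m = n + k - 1"
  have m: "n + k = Suc m" using False by (simp add: m_def)
  have diff: "Suc m - 2 * k = n - k" using m assms by linarith
  have nk: "(n + k) choose (n - k) = Suc m choose (2 * k)"
    using binomial_symmetric[of "2 * k" "Suc m"] assms unfolding m diff by (simp flip: m)
  have "(Suc m - 2 * k) * (Suc m choose (2 * k)) = Suc m * (m choose (2 * k))"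
    using binomial_absorb_comp[of "Suc m" "2 * k"] by simp
  then have "real (n - k) * real (Suc m choose (2 * k)) = real (Suc m) * real (m choose (2 * k))"
    unfolding diff by (metis of_nat_mult)
  then have "(real n - real k) * real (Suc m choose (2 * k)) = (real n + real k) * real (m choose (2 * k))"
    using assms m by (metis of_nat_add of_nat_diff)
  moreover have "real n + real k > 0" using False by simp
  ultimately show ?thesis
    unfolding ncoeff_def avg_binom_def nk m_def[symmetric] unfolding m[symmetric] using False
    by (simp add: field_simps)
qed

lemma avg_binom_eq_0: "n < k \<Longrightarrow> avg_binom n k = 0"
  by (simp add: avg_binom_def binomial_eq_0)

lemma avg_binom_0_right: "avg_binom n 0 = 1"
  by (simp add: avg_binom_def)

text \<open>Pascal's rule applied twice: the second difference of \<open>C(N, 2k+2)\<close> in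
  \<open>N\<close> is \<open>C(N, 2k)\<close>. It applies to each of the two averaged binomials,
  with \<open>N = n+k+1\<close> and \<open>N = n+k\<close>.\<close>

lemma avg_binom_rec:
  "avg_binom (n + 2) (Suc k) = avg_binom (n + 1) k + 2 * avg_binom (n + 1) (Suc k) - avg_binom n (Suc k)"
  by (simp add: avg_binom_def field_simps)

lemma sum_avg_binom_rec:
  fixes x :: real
  shows "(\<Sum>k\<le>n + 2. avg_binom (n + 2) k * x ^ k)
       = (x + 2) * (\<Sum>k\<le>n + 1. avg_binom (n + 1) k * x ^ k) - (\<Sum>k\<le>n. avg_binom n k * x ^ k)"
proof -
  \<comment> \<open>The coefficient recurrence covers only positive exponents, so the constant term
    1 is split off. Padding with zero coefficients gives all three sums a common range.\<close>
  define S where "S m = (\<Sum>k\<le>n + 1. avg_binom m (Suc k) * x ^ Suc k)" for m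
  have S: "(\<Sum>k\<le>m. avg_binom m k * x ^ k) = 1 + S m" if "m \<le> n + 2" for m
  proof -
    have "(\<Sum>k\<le>m. avg_binom m k * x ^ k) = (\<Sum>k\<le>Suc (n + 1). avg_binom m k * x ^ k)"
      by (rule sum.mono_neutral_left) (use that in \<open>auto simp: avg_binom_eq_0\<close>)
    also have "\<dots> = 1 + S m"
      by (subst sum.atMost_Suc_shift) (simp add: S_def avg_binom_0_right)
    finally show ?thesis .
  qed
  have "S (n + 2) = x * (\<Sum>k\<le>n + 1. avg_binom (n + 1) k * x ^ k) + 2 * S (n + 1) - S n"
    unfolding S_def avg_binom_rec sum_distrib_left sum.distrib[symmetric] sum_subtractf[symmetric]
    by (intro sum.cong) (auto simp: algebra_simps)
  then show ?thesis
    unfolding S[OF order_refl] S[of "n + 1", OF add_left_mono[OF one_le_numeral]] S[of n, OF le_add1]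
    by (simp add: algebra_simps)
qed

text \<open>For \<open>x = w + 1/w - 2\<close> the recurrence has characteristic roots
  \<open>w\<close> and \<open>1/w\<close>; two initial values then fix the solution. The polynomial
  is the Chebyshev polynomial \<open>T_n\<close> at \<open>1 + x/2\<close>.\<close>

lemma sum_avg_binom_closed:
  fixes w :: real
  assumes "w \<noteq> 0"
  shows "(\<Sum>k\<le>n. avg_binom n k * (w + 1 / w - 2) ^ k) = (w ^ n + (1 / w) ^ n) / 2"
proof (induction n rule: induct_nat_012)
  case 0
  then show ?case by (simp add: avg_binom_0_right)
next
  case 1
  then show ?case by (simp add: avg_binom_def numeral_2_eq_2 field_simps)
next
  case (ge2 n)
  define v where "v = 1 / w"
  define S where "S m = (\<Sum>k\<le>m. avg_binom m k * (w + v - 2) ^ k)" for m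
  have wv: "w * v = 1" using assms by (simp add: v_def)
  have "(w + v) * (w ^ Suc n + v ^ Suc n) = w ^ Suc (Suc n) + v ^ Suc (Suc n) + (w * v) * (w ^ n + v ^ n)"
    by (simp add: algebra_simps)
  moreover have "S (Suc (Suc n)) = (w + v) * S (Suc n) - S n"
    using sum_avg_binom_rec[of n "w + v - 2", folded S_def] by simp
  moreover have "S n = (w ^ n + v ^ n) / 2" "S (Suc n) = (w ^ Suc n + v ^ Suc n) / 2"
    using ge2 unfolding S_def v_def by blast+
  ultimately have "S (Suc (Suc n)) = (w ^ Suc (Suc n) + v ^ Suc (Suc n)) / 2"
    by (simp only: wv times_divide_eq_right) (simp add: diff_divide_distrib add_divide_distrib)
  then show ?case unfolding S_def v_def .
qed

text \<open>Each \<open>z ^ k\<close> supplies the factor \<open>c ^ k\<close> that completes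
  \<open>c ^ (n - k)\<close> to \<open>c ^ n\<close>, which leaves the sum.\<close>

lemma sum_ncoeff_closed:
  fixes c w z :: real
  assumes "c \<noteq> 0" "w \<noteq> 0" "z = c * (w + 1 / w - 2)"
  shows "(\<Sum>k=0..n. c ^ (n - k) * ncoeff n k * z ^ k) = ((c * w) ^ n + (c / w) ^ n) / 2"
proof -
  have "(\<Sum>k=0..n. c ^ (n - k) * ncoeff n k * z ^ k)
      = (\<Sum>k\<le>n. c ^ n * (avg_binom n k * (w + 1 / w - 2) ^ k))"
    unfolding atMost_atLeast0
  proof (intro sum.cong refl)
    fix k assume "k \<in> {0..n}"
    then have "k \<le> n" by simp
    then have "c ^ n = c ^ (n - k) * c ^ k" by (simp flip: power_add)
    then show "c ^ (n - k) * ncoeff n k * z ^ k = c ^ n * (avg_binom n k * (w + 1 / w - 2) ^ k)"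
      using ncoeff_eq_avg_binom[OF \<open>k \<le> n\<close>] by (simp add: assms(3) power_mult_distrib)
  qed
  also have "\<dots> = ((c * w) ^ n + (c / w) ^ n) / 2"
    unfolding sum_distrib_left[symmetric] sum_avg_binom_closed[OF assms(2)]
    by (simp add: power_mult_distrib power_divide algebra_simps)
  finally show ?thesis .
qed

section \<open>Binet formulas at integer indices\<close>

definition golden :: real where "golden = (1 + sqrt 5) / 2"
definition golden_conj :: real where "golden_conj = (1 - sqrt 5) / 2"

lemma golden_mult_conj: "golden * golden_conj = -1"
  by (simp add: golden_def golden_conj_def field_simps)

lemma golden_power_rec:
  "golden ^ Suc (Suc n) = golden ^ Suc n + golden ^ n"
  "golden_conj ^ Suc (Suc n) = golden_conj ^ Suc n + golden_conj ^ n"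
proof -
  have "golden * golden = golden + 1" "golden_conj * golden_conj = golden_conj + 1"
    by (simp_all add: golden_def golden_conj_def field_simps)
  then show "golden ^ Suc (Suc n) = golden ^ Suc n + golden ^ n"
    "golden_conj ^ Suc (Suc n) = golden_conj ^ Suc n + golden_conj ^ n"
    by (simp_all add: distrib_right flip: mult.assoc)
qed

lemma fib_binet: "real (fib n) * sqrt 5 = golden ^ n - golden_conj ^ n"
proof (induction n rule: fib.induct)
  case (3 n)
  then show ?case unfolding golden_power_rec by (simp add: distrib_right)
qed (simp_all add: golden_def golden_conj_def field_simps)

lemma lucas_binet: "real (lucas n) = golden ^ n + golden_conj ^ n"
proof (induction n rule: lucas.induct)
  case (3 n)
  then show ?case unfolding golden_power_rec by simp
qed (simp_all add: golden_def golden_conj_def field_simps)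

text \<open>The roots have product -1, so inverting one gives minus the other.\<close>

lemma golden_power_int_minus:
  "golden powi (- int n) = (-1) ^ n * golden_conj ^ n"
  "golden_conj powi (- int n) = (-1) ^ n * golden ^ n"
proof -
  have "inverse golden = - golden_conj" "inverse golden_conj = - golden"
    using golden_mult_conj by (intro inverse_unique; simp add: mult.commute)+
  then show "golden powi (- int n) = (-1) ^ n * golden_conj ^ n"
    "golden_conj powi (- int n) = (-1) ^ n * golden ^ n"
    by (simp_all add: power_int_minus flip: power_inverse power_mult_distrib)
qed

lemma fib_int_binet: "real_of_int (fib_int p) * sqrt 5 = golden powi p - golden_conj powi p"
proof (cases p rule: int_cases2)
  case (nonneg n)
  then show ?thesis by (simp add: fib_int_def fib_binet)
next
  case (nonpos n)
  show ?thesis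
  proof (cases n)
    case 0
    then show ?thesis by (simp add: nonpos fib_int_def)
  next
    case (Suc m)
    \<comment> \<open>The exponent is \<open>m = n - 1\<close>; the missing sign comes from the two
      roots trading places in the difference.\<close>
    have "real_of_int (fib_int p) * sqrt 5 = (-1) ^ m * (real (fib n) * sqrt 5)"
      by (simp add: nonpos Suc fib_int_def nat_add_distrib)
    then show ?thesis
      unfolding nonpos golden_power_int_minus fib_binet by (simp add: Suc algebra_simps)
  qed
qed

lemma lucas_int_binet: "real_of_int (lucas_int p) = golden powi p + golden_conj powi p"
proof (cases p rule: int_cases2)
  case (nonneg n)
  then show ?thesis by (simp add: lucas_int_def lucas_binet)
next
  case (nonpos n)
  have "real_of_int (lucas_int p) = (-1) ^ n * real (lucas n)"
    by (simp add: nonpos lucas_int_minus) (simp add: lucas_int_def)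
  then show ?thesis
    unfolding nonpos golden_power_int_minus lucas_binet by (simp add: algebra_simps)
qed

section \<open>Nonvanishing, and values at \<open>2p\<close> and \<open>3p\<close>\<close>

lemma fib_int_nonzero: "p \<noteq> 0 \<Longrightarrow> fib_int p \<noteq> 0"
  using fib_neq_0_nat by (auto simp: fib_int_def)

lemma lucas_pos: "lucas n > 0"
  by (induction n rule: lucas.induct) auto

lemma lucas_int_nonzero: "lucas_int p \<noteq> 0"
  using lucas_pos[of "nat p"] lucas_pos[of "nat (- p)"] by (auto simp: lucas_int_def)

text \<open>With \<open>a\<close>, \<open>b\<close> the \<open>p\<close>-th powers of the two roots,
  these are the factorizations of \<open>a^2 - b^2\<close>, \<open>a^3 - b^3\<close> and
  \<open>a^3 + b^3\<close>, where \<open>a * b = s\<close> and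
  \<open>(a - b)^2 = 5 F^2\<close>.\<close>

lemma fib_lucas_int_multiples:
  fixes p :: int
  defines "F \<equiv> real_of_int (fib_int p)" and "L \<equiv> real_of_int (lucas_int p)"
    and "s \<equiv> (-1 :: real) powi p"
  shows "real_of_int (fib_int (2 * p)) = F * L"
    and "real_of_int (fib_int (3 * p)) = F * (L ^ 2 - s)"
    and "real_of_int (lucas_int (3 * p)) = L * (5 * F ^ 2 + s)"
proof -
  define a where "a = golden powi p"
  define b where "b = golden_conj powi p"
  have s: "s = a * b"
    by (simp add: s_def a_def b_def flip: power_int_mult_distrib golden_mult_conj)
  have mult: "golden powi (2 * p) = a ^ 2" "golden_conj powi (2 * p) = b ^ 2"
    "golden powi (3 * p) = a ^ 3" "golden_conj powi (3 * p) = b ^ 3"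
    by (simp_all add: a_def b_def power_int_mult mult.commute[of _ p])
  have F: "F * sqrt 5 = a - b" and L: "L = a + b"
    by (simp_all add: F_def L_def a_def b_def fib_int_binet lucas_int_binet)
  have "real_of_int (fib_int (2 * p)) * sqrt 5 = (a - b) * L"
    unfolding fib_int_binet mult L by (simp add: power2_eq_square algebra_simps)
  also have "\<dots> = F * L * sqrt 5" by (simp flip: F)
  finally show "real_of_int (fib_int (2 * p)) = F * L" by simp
  have "real_of_int (fib_int (3 * p)) * sqrt 5 = (a - b) * (L ^ 2 - s)"
    unfolding fib_int_binet mult L s by (simp add: power2_eq_square power3_eq_cube algebra_simps)
  also have "\<dots> = F * (L ^ 2 - s) * sqrt 5" by (simp flip: F)
  finally show "real_of_int (fib_int (3 * p)) = F * (L ^ 2 - s)" by simp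
  have F2: "5 * F ^ 2 = (a - b) ^ 2" by (simp add: power_mult_distrib flip: F)
  show "real_of_int (lucas_int (3 * p)) = L * (5 * F ^ 2 + s)"
    unfolding lucas_int_binet mult L s F2 by (simp add: power2_eq_square power3_eq_cube algebra_simps)
qed

section \<open>Evaluation of the two sums\<close>

theorem theorem13:
  fixes n :: nat and p :: int
  assumes "p \<noteq> 0"
  shows "(\<Sum>k=0..n. (-1) powi (p * (int n - int k)) * ncoeff n k *
            (real_of_int (fib_int (3 * p)) / real_of_int (fib_int (2 * p))) ^ (2 * k))
         = (real_of_int (lucas_int p) ^ (4 * n) + 1) / (2 * real_of_int (lucas_int p) ^ (2 * n))
       \<and> (\<Sum>k=0..n. (-1) powi ((p + 1) * (int n - int k)) * ncoeff n k * 5 ^ (n - k) *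
            (real_of_int (lucas_int (3 * p)) / real_of_int (fib_int (2 * p))) ^ (2 * k))
         = (5 ^ (2 * n) * real_of_int (fib_int p) ^ (4 * n) + 1) / (2 * real_of_int (fib_int p) ^ (2 * n))"
proof -
  define F where "F = real_of_int (fib_int p)"
  define L where "L = real_of_int (lucas_int p)"
  define s :: real where "s = (-1) powi p"
  have F: "F \<noteq> 0" and L: "L \<noteq> 0"
    using fib_int_nonzero[OF assms] lucas_int_nonzero[of p] by (simp_all add: F_def L_def)
  have s: "s = 1 \<or> s = -1"
    by (auto simp: s_def power_int_minus_left)
  have sign: "(-1 :: real) powi (q * (int n - int k)) = ((-1) powi q) ^ (n - k)"
    if "k \<in> {0..n}" for q :: int and k
    using that by (simp add: power_int_mult flip: of_nat_diff)
  have s': "(-1 :: real) powi (p + 1) = - s"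
    by (simp add: s_def power_int_add)
  note mults = fib_lucas_int_multiples[of p, folded F_def L_def s_def]
  have "(\<Sum>k=0..n. (-1) powi (p * (int n - int k)) * ncoeff n k *
            (real_of_int (fib_int (3 * p)) / real_of_int (fib_int (2 * p))) ^ (2 * k))
      = (\<Sum>k=0..n. s ^ (n - k) * ncoeff n k * ((L - s / L) ^ 2) ^ k)"
    using F L by (intro sum.cong refl)
      (simp add: sign mults power_mult diff_divide_distrib power2_eq_square flip: s_def)
  \<comment> \<open>As \<open>s^2 = 1\<close>, the square
    \<open>(L - s/L)^2 = L^2 + 1/L^2 - 2 s\<close> is \<open>s (w + 1/w - 2)\<close> with
    \<open>w = s L^2\<close>.\<close>
  also have "\<dots> = ((s * (s * L ^ 2)) ^ n + (s / (s * L ^ 2)) ^ n) / 2"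
    by (rule sum_ncoeff_closed) (use s L in \<open>auto simp: field_simps power2_eq_square\<close>)
  also have "s * (s * L ^ 2) = L ^ 2" using s by auto
  also have "s / (s * L ^ 2) = 1 / L ^ 2" using s by auto
  also have "((L ^ 2) ^ n + (1 / L ^ 2) ^ n) / 2 = (L ^ (4 * n) + 1) / (2 * L ^ (2 * n))"
  proof -
    have eq: "L ^ (4 * n) = (L ^ 2) ^ n * (L ^ 2) ^ n" "L ^ (2 * n) = (L ^ 2) ^ n"
      by (simp_all flip: power_mult power_add)
    show ?thesis using L unfolding eq
      by (simp add: power_divide field_simps)
  qed
  finally have 1: "(\<Sum>k=0..n. (-1) powi (p * (int n - int k)) * ncoeff n k *
            (real_of_int (fib_int (3 * p)) / real_of_int (fib_int (2 * p))) ^ (2 * k))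
      = (L ^ (4 * n) + 1) / (2 * L ^ (2 * n))" .
  have "(\<Sum>k=0..n. (-1) powi ((p + 1) * (int n - int k)) * ncoeff n k * 5 ^ (n - k) *
            (real_of_int (lucas_int (3 * p)) / real_of_int (fib_int (2 * p))) ^ (2 * k))
      = (\<Sum>k=0..n. (- 5 * s) ^ (n - k) * ncoeff n k * ((5 * F + s / F) ^ 2) ^ k)"
  proof (intro sum.cong refl)
    fix k assume k: "k \<in> {0..n}"
    \<comment> \<open>The alternating sign, a power of \<open>- s\<close>, and the power of 5 share
      the exponent \<open>n - k\<close> and merge into one base.\<close>
    have "(- 5 * s) ^ (n - k) = (- s) ^ (n - k) * 5 ^ (n - k)"
      by (simp add: mult.commute flip: power_mult_distrib)
    moreover have "real_of_int (lucas_int (3 * p)) / real_of_int (fib_int (2 * p)) = 5 * F + s / F"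
      using F L unfolding mults by (simp add: field_simps power2_eq_square)
    ultimately show "(-1) powi ((p + 1) * (int n - int k)) * ncoeff n k * 5 ^ (n - k) *
            (real_of_int (lucas_int (3 * p)) / real_of_int (fib_int (2 * p))) ^ (2 * k)
      = (- 5 * s) ^ (n - k) * ncoeff n k * ((5 * F + s / F) ^ 2) ^ k"
      unfolding sign[OF k] s' by (simp add: power_mult)
  qed
  \<comment> \<open>Here \<open>(5 F + s/F)^2 = 25 F^2 + 1/F^2 + 10 s\<close>; matching
    \<open>10 s\<close> with \<open>-2 c\<close> forces \<open>c = -5 s\<close>, and
    \<open>c w = 25 F^2\<close> then gives \<open>w\<close>.\<close>
  also have "\<dots> = ((- 5 * s * (- 5 * s * F ^ 2)) ^ n + (- 5 * s / (- 5 * s * F ^ 2)) ^ n) / 2"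
    by (rule sum_ncoeff_closed) (use s F in \<open>auto simp: field_simps power2_eq_square\<close>)
  also have "- 5 * s * (- 5 * s * F ^ 2) = 5 ^ 2 * F ^ 2" using s by auto
  also have "- 5 * s / (- 5 * s * F ^ 2) = 1 / F ^ 2" using s by auto
  also have "((5 ^ 2 * F ^ 2) ^ n + (1 / F ^ 2) ^ n) / 2
      = (5 ^ (2 * n) * F ^ (4 * n) + 1) / (2 * F ^ (2 * n))"
  proof -
    have eq: "F ^ (4 * n) = (F ^ 2) ^ n * (F ^ 2) ^ n" "F ^ (2 * n) = (F ^ 2) ^ n"
      by (simp_all flip: power_mult power_add)
    have "5 ^ (2 * n) = (5 ^ 2 :: real) ^ n" by (rule power_mult)
    then show ?thesis using F unfolding eq
      by (simp add: power_mult_distrib power_divide field_simps)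
  qed
  finally show ?thesis using 1 unfolding F_def L_def by blast
qed

end
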